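(* Let $X$ be a separable real Hilbert space, $M\in\mathbb{N}$, $\Sigma\in\mathbb{R}^{M\times M}$ symmetric positive-definite, and let $\Phi(u;y)=\frac12\|\mathcal{G}(u)-y\|_{\Sigma}^2$ for $u\in X$, $y\in\mathbb{R}^M$, where the forward map $\mathcal{G}:X\to\mathbb{R}^M$ is locally Lipschitz continuous and polynomially bounded, i.e. there exist $C>0$ and $q\in\mathbb{N}$ such that $\|\mathcal{G}(u)\|_2\le C\max\{1,\|u\|_X^q\}$ for all $u\in X$. If $\mu_0$ is a $BK(p,\mathcal{R})$ prior with $p>0$ and a Hilbert-Schmidt operator $\mathcal{R}:X\to X$ (with eigenvalues $\{\gamma_k\}_{k=1}^\infty\in\ell^2$ and eigenvectors $\{r_k\}_{k=1}^\infty$ forming an orthonormal basis of $X$), then the Bayesian inverse problem $$\frac{d\mu^{y}}{d\mu_0}(u)=\frac{1}{Z(y)}\exp(-\Phi(u;y)),\qquad Z(y)=\int_X\exp(-\Phi(u;y))\,d\mu_0(u),$$ is well-posed.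
   Context: Notation: $\|\cdot\|_{\Sigma}:=\|\Sigma^{-1/2}\cdot\|_2$; $P(X)$ is the set of Radon probability measures on $X$. Bessel-K prior: for $p>0$, $BK(p,1)$ is the probability measure on $\mathbb{R}$ with Lebesgue density $t\mapsto \frac{1}{\sqrt{\pi}\,\Gamma(p)\,2^{p-1/2}}|t|^{p-1/2}K_{p-1/2}(|t|)$, where $K_\alpha$ is the modified Bessel function of the second kind; equivalently it is the law of the difference of two independent Gamma random variables with shape $p$ and scale $1$. $BK(p,\mathcal{R})$ denotes the law of $u=\sum_{k=1}^\infty\gamma_k\eta_kr_k$ with $\{\eta_k\}$ i.i.d. $BK(p,1)$ random variables. Hellinger metric on $P(X)$: $d_H(\mu_1,\mu_2)=\left(\frac12\int_X\left(\sqrt{d\mu_1/d\Theta}-\sqrt{d\mu_2/d\Theta}\right)^2d\Theta\right)^{1/2}$, where $\Theta\in P(X)$ is any measure with $\mu_1\ll\Theta$ and $\mu_2\ll\Theta$. Well-posedness: the Bayesian inverse problem is well-posed if (1) for each $y\in\mathbb{R}^M$ there exists a unique posterior probability measure $\mu^y\ll\mu_0$ given by the formula in the claim; and (2) for each $y\in\mathbb{R}^M$ and any $\epsilon>0$ there is $\delta>0$ such that if $\|y-y'\|_2<\delta$ then $d_H(\mu^y,\mu^{y'})<\epsilon$. *)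

theory Defs
  imports "HOL-Probability.Probability"
begin

section \<open>Operators and orthonormal bases\<close>

text \<open>Completeness of the system is expressed by density of its linear span.\<close>

definition orthonormal_basis :: "'i set \<Rightarrow> ('i \<Rightarrow> 'a::real_inner) \<Rightarrow> bool" where
  "orthonormal_basis I e \<longleftrightarrow>
     (\<forall>i\<in>I. \<forall>j\<in>I. e i \<bullet> e j = (if i = j then 1 else 0)) \<and> closure (span (e ` I)) = UNIV"

definition hilbert_schmidt :: "('a::real_inner \<Rightarrow> 'a) \<Rightarrow> bool" where
  "hilbert_schmidt R \<longleftrightarrow> bounded_linear R \<and>
     (\<exists>E. orthonormal_basis E (\<lambda>e. e) \<and> (\<lambda>e. (norm (R e))\<^sup>2) summable_on E)"


section \<open>The weighted norm on the data space\<close>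

definition sym_pos_def :: "real^'m^'m \<Rightarrow> bool" where
  "sym_pos_def A \<longleftrightarrow> transpose A = A \<and> (\<forall>v. v \<noteq> 0 \<longrightarrow> 0 < v \<bullet> (A *v v))"

text \<open>A symmetric positive-definite matrix has exactly one symmetric positive-definite square root,
  so the description is proper for the matrices of interest.\<close>

definition matrix_sqrt :: "real^'m^'m \<Rightarrow> real^'m^'m" where
  "matrix_sqrt A = (THE S. sym_pos_def S \<and> S ** S = A)"

definition weighted_norm :: "real^'m^'m \<Rightarrow> real^'m \<Rightarrow> real" where
  "weighted_norm \<Sigma> v = norm (matrix_inv (matrix_sqrt \<Sigma>) *v v)"


section \<open>Forward maps and the potential\<close>

definition locally_lipschitz :: "('a::metric_space \<Rightarrow> 'b::metric_space) \<Rightarrow> bool" where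
  "locally_lipschitz f \<longleftrightarrow> (\<forall>u. \<exists>e>0. \<exists>L. L-lipschitz_on (ball u e) f)"

definition polynomially_bounded ::
    "('a::real_normed_vector \<Rightarrow> 'b::real_normed_vector) \<Rightarrow> bool" where
  "polynomially_bounded f \<longleftrightarrow>
     (\<exists>C>0. \<exists>q::nat. \<forall>u. norm (f u) \<le> C * max 1 (norm u ^ q))"

definition potential :: "real^'m^'m \<Rightarrow> ('a \<Rightarrow> real^'m) \<Rightarrow> 'a \<Rightarrow> real^'m \<Rightarrow> real" where
  "potential \<Sigma> G u y = 1 / 2 * (weighted_norm \<Sigma> (G u - y))\<^sup>2"


section \<open>Bessel-K priors\<close>

text \<open>The modified Bessel function of the second kind, for an argument \<open>x > 0\<close>, by its classical
  integral representation \<open>K\<^sub>\<alpha>(x) = \<integral>\<^sub>0\<^sup>\<infinity> exp (- x cosh t) cosh (\<alpha> t) dt\<close>. Unlike the formula in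
  terms of \<open>I\<^sub>\<alpha>\<close> and \<open>I\<^sub>-\<^sub>\<alpha>\<close>, it needs no limit at integer orders.\<close>

definition Bessel_K :: "real \<Rightarrow> real \<Rightarrow> real" where
  "Bessel_K \<alpha> x = (LINT t:{0..}|lborel. exp (- x * cosh t) * cosh (\<alpha> * t))"

text \<open>The value of the density at the single point \<open>0\<close> is immaterial.\<close>

definition BK_density :: "real \<Rightarrow> real \<Rightarrow> real" where
  "BK_density p t =
     1 / (sqrt pi * Gamma p * 2 powr (p - 1 / 2)) * \<bar>t\<bar> powr (p - 1 / 2) * Bessel_K (p - 1 / 2) \<bar>t\<bar>"

definition BK1 :: "real \<Rightarrow> real measure" where
  "BK1 p = density lborel (\<lambda>t. ennreal (BK_density p t))"

text \<open>An i.i.d. sequence is realised by the coordinates of the infinite product space. The operator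
  enters through its eigenvalues \<open>\<gamma>\<close> and eigenvectors \<open>r\<close>. For \<open>\<gamma>\<close> square-summable and \<open>r\<close>
  orthonormal the random series converges almost surely, so the arbitrary value of the infinite sum
  on divergent samples does not affect the law.\<close>

definition BK_prior ::
    "real \<Rightarrow> (nat \<Rightarrow> real) \<Rightarrow> (nat \<Rightarrow> 'a::{real_inner, banach}) \<Rightarrow> 'a measure" where
  "BK_prior p \<gamma> r =
     distr (\<Pi>\<^sub>M k\<in>(UNIV::nat set). BK1 p) borel (\<lambda>\<eta>. \<Sum>k. (\<gamma> k * \<eta> k) *\<^sub>R r k)"


section \<open>Radon probability measures and the Hellinger metric\<close>

definition radon_prob :: "'a::topological_space measure set" where
  "radon_prob = {\<mu>. prob_space \<mu> \<and> sets \<mu> = sets borel \<and>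
     (\<forall>B\<in>sets borel. emeasure \<mu> B = (SUP K\<in>{K. K \<subseteq> B \<and> compact K}. emeasure \<mu> K))}"

text \<open>The integral does not depend on the choice of the dominating measure \<open>\<Theta>\<close>, and
  \<open>(\<mu> + \<nu>) / 2\<close> is always a possible one. In the library, \<open>absolutely_continuous \<Theta> \<mu>\<close> means that
  \<open>\<mu>\<close> is absolutely continuous with respect to \<open>\<Theta>\<close>, and \<open>RN_deriv \<Theta> \<mu>\<close> is the density of \<open>\<mu>\<close> with
  respect to \<open>\<Theta>\<close>.\<close>

definition hellinger :: "'a::topological_space measure \<Rightarrow> 'a measure \<Rightarrow> real" where
  "hellinger \<mu> \<nu> =
     (let \<Theta> = (SOME \<Theta>. \<Theta> \<in> radon_prob \<and> absolutely_continuous \<Theta> \<mu> \<and> absolutely_continuous \<Theta> \<nu>)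
      in sqrt (1 / 2 * (LINT u|\<Theta>. (sqrt (enn2real (RN_deriv \<Theta> \<mu> u))
                                 - sqrt (enn2real (RN_deriv \<Theta> \<nu> u)))\<^sup>2)))"


section \<open>Bayesian inverse problems\<close>

definition evidence :: "'a measure \<Rightarrow> ('a \<Rightarrow> 'd \<Rightarrow> real) \<Rightarrow> 'd \<Rightarrow> real" where
  "evidence \<mu>\<^sub>0 \<Phi> y = (LINT u|\<mu>\<^sub>0. exp (- \<Phi> u y))"

definition is_posterior ::
    "'a::topological_space measure \<Rightarrow> ('a \<Rightarrow> 'd \<Rightarrow> real) \<Rightarrow> 'd \<Rightarrow> 'a measure \<Rightarrow> bool" where
  "is_posterior \<mu>\<^sub>0 \<Phi> y \<mu> \<longleftrightarrow> \<mu> \<in> radon_prob \<and> absolutely_continuous \<mu>\<^sub>0 \<mu> \<and>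
     (AE u in \<mu>\<^sub>0. RN_deriv \<mu>\<^sub>0 \<mu> u = ennreal (1 / evidence \<mu>\<^sub>0 \<Phi> y * exp (- \<Phi> u y)))"

definition posterior ::
    "'a::topological_space measure \<Rightarrow> ('a \<Rightarrow> 'd \<Rightarrow> real) \<Rightarrow> 'd \<Rightarrow> 'a measure" where
  "posterior \<mu>\<^sub>0 \<Phi> y = (THE \<mu>. is_posterior \<mu>\<^sub>0 \<Phi> y \<mu>)"

definition well_posed ::
    "'a::topological_space measure \<Rightarrow> ('a \<Rightarrow> 'd::real_normed_vector \<Rightarrow> real) \<Rightarrow> bool" where
  "well_posed \<mu>\<^sub>0 \<Phi> \<longleftrightarrow>
     (\<forall>y. \<exists>!\<mu>. is_posterior \<mu>\<^sub>0 \<Phi> y \<mu>) \<and>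
     (\<forall>y. \<forall>\<epsilon>>0. \<exists>\<delta>>0. \<forall>y'. norm (y - y') < \<delta> \<longrightarrow>
        hellinger (posterior \<mu>\<^sub>0 \<Phi> y) (posterior \<mu>\<^sub>0 \<Phi> y') < \<epsilon>)"

end

theory Submission
  imports Defs
begin

text \<open>All posteriors are equivalent to the prior \<open>\<mu>\<^sub>0\<close>, so that the Hellinger distance can be computed
  with \<open>\<mu>\<^sub>0\<close> as dominating measure, where
  \<open>d\<^sub>H(\<mu>\<^sup>y, \<mu>\<^sup>z)\<^sup>2 = 1 - \<integral> exp (- (\<Phi>(u;y) + \<Phi>(u;z)) / 2) d\<mu>\<^sub>0 / \<surd>(Z(y) Z(z))\<close>. Since \<open>0 \<le> \<Phi>\<close> and \<open>\<Phi>\<close> is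
  continuous in \<open>y\<close>, dominated convergence with the constant majorant \<open>1\<close> makes this continuous in \<open>z\<close>;
  it vanishes at \<open>z = y\<close>. What remains is that the prior is a probability measure, that is, that the
  Bessel-K density integrates to \<open>1\<close>; a substitution in the double integral reduces this to the Gamma
  and Gaussian integrals.\<close>

section \<open>Substitution, reflection and Gaussian integrals on the half-line\<close>

text \<open>The substitution v = exp t is carried out on compact intervals. These exhaust the line
  while their images under exp exhaust the open half-line, and monotone convergence gives the
  claim.\<close>

lemma nn_integral_exp_substitution:
  fixes f :: "real \<Rightarrow> ennreal"
  assumes [measurable]: "f \<in> borel_measurable borel"
  shows "(\<integral>\<^sup>+t. f (exp t) * ennreal (exp t) \<partial>lborel) = (\<integral>\<^sup>+v. f v * indicator {0<..} v \<partial>lborel)"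
proof -
  have "(\<Union>n. {exp (- real (Suc n))..exp (real (Suc n))}) = {0<..}"
  proof (intro equalityI subsetI)
    fix v :: real assume "v \<in> {0<..}"
    obtain n where "\<bar>ln v\<bar> \<le> real n" using real_arch_simple by blast
    then have "ln v \<in> {- real (Suc n)..real (Suc n)}" by auto
    then have "exp (ln v) \<in> {exp (- real (Suc n))..exp (real (Suc n))}"
      by (simp only: atLeastAtMost_iff exp_le_cancel_iff)
    then have "v \<in> {exp (- real (Suc n))..exp (real (Suc n))}"
      using \<open>v \<in> {0<..}\<close> by (metis exp_ln greaterThan_iff)
    then show "v \<in> (\<Union>n. {exp (- real (Suc n))..exp (real (Suc n))})" by blast
  qed (auto intro: less_le_trans[OF exp_gt_zero])
  moreover have "(\<Union>n. {- real (Suc n)..real (Suc n)}) = UNIV"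
  proof (intro equalityI subsetI)
    fix t :: real
    obtain n where "\<bar>t\<bar> \<le> real n" using real_arch_simple by blast
    then have "t \<in> {- real (Suc n)..real (Suc n)}" by auto
    then show "t \<in> (\<Union>n. {- real (Suc n)..real (Suc n)})" by blast
  qed simp
  moreover have inc: "incseq (\<lambda>n. {- real (Suc n)..real (Suc n)})"
    "incseq (\<lambda>n. {exp (- real (Suc n))..exp (real (Suc n))})"
    by (auto simp: incseq_def intro: order_trans)
  \<comment> \<open>\<open>Suc n\<close> in place of \<open>n\<close> keeps the interval
    nondegenerate for n = 0 as well.\<close>
  moreover have "(\<integral>\<^sup>+v. f v * indicator {exp (- real (Suc n))..exp (real (Suc n))} v \<partial>lborel) =
      (\<integral>\<^sup>+t. f (exp t) * ennreal (exp t) * indicator {- real (Suc n)..real (Suc n)} t \<partial>lborel)" for n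
    by (rule nn_integral_substitution_aux)
       (auto intro!: derivative_eq_intros continuous_intros)
  \<comment> \<open>Continuity from below of the measure with density \<open>h\<close>, to be
    applied on both sides of the substitution.\<close>
  moreover have "(\<integral>\<^sup>+x. h x * indicator (\<Union>n. A n) x \<partial>lborel) = (SUP n. \<integral>\<^sup>+x. h x * indicator (A n) x \<partial>lborel)"
    if [measurable]: "h \<in> borel_measurable borel" "\<And>n. A n \<in> sets borel" and "incseq A"
    for h :: "real \<Rightarrow> ennreal" and A :: "nat \<Rightarrow> real set"
  proof -
    have "(SUP n. emeasure (density lborel h) (A n)) = emeasure (density lborel h) (\<Union>n. A n)"
      by (rule SUP_emeasure_incseq) (use that in auto)
    then show ?thesis by (simp add: emeasure_density)
  qed
  note this[of f, OF _ _ inc(2)] this[of "\<lambda>t. f (exp t) * ennreal (exp t)", OF _ _ inc(1)]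
  ultimately show ?thesis by simp
qed

text \<open>Split at the null set {0} and reflect the negative half-line. For an even integrand the
  two summands agree; for exp (- x cosh t) exp (- \<nu> t) they combine to a cosh.\<close>

lemma nn_integral_even:
  fixes f :: "real \<Rightarrow> ennreal"
  assumes [measurable]: "f \<in> borel_measurable borel"
  shows "(\<integral>\<^sup>+t. f t \<partial>lborel) = (\<integral>\<^sup>+t. (f t + f (- t)) * indicator {0<..} t \<partial>lborel)"
proof -
  have "(\<integral>\<^sup>+t. f t \<partial>lborel) = (\<integral>\<^sup>+t. f t * indicator {0<..} t + f t * indicator {..<0} t \<partial>lborel)"
    by (rule nn_integral_cong_AE, rule AE_mp[OF AE_lborel_singleton[of 0]])
       (auto split: split_indicator)
  also have "\<dots> = (\<integral>\<^sup>+t. f t * indicator {0<..} t \<partial>lborel) + (\<integral>\<^sup>+t. f t * indicator {..<0} t \<partial>lborel)"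
    by (rule nn_integral_add) auto
  also have "(\<integral>\<^sup>+t. f t * indicator {..<0} t \<partial>lborel) = (\<integral>\<^sup>+t. f (- t) * indicator {0<..} t \<partial>lborel)"
    by (subst nn_integral_real_affine[where c = "- 1" and t = 0])
       (auto intro!: nn_integral_cong split: split_indicator)
  also have "(\<integral>\<^sup>+t. f t * indicator {0<..} t \<partial>lborel) + \<dots> =
      (\<integral>\<^sup>+t. (f t + f (- t)) * indicator {0<..} t \<partial>lborel)"
    by (subst nn_integral_add[symmetric]) (auto simp: distrib_right)
  finally show ?thesis .
qed

text \<open>Rescaling v by \<open>sqrt s\<close> reduces this to s = 1, the zeroth Gaussian
  moment.\<close>

lemma nn_integral_gaussian_half_line:
  assumes "s > 0"
  shows "(\<integral>\<^sup>+v. ennreal (exp (- s * v\<^sup>2)) * indicator {0<..} v \<partial>lborel) = ennreal (sqrt (pi / s) / 2)"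
proof -
  have "(\<integral>\<^sup>+v. ennreal (exp (- v\<^sup>2)) * indicator {0<..} v \<partial>lborel) =
      (\<integral>\<^sup>+v. ennreal (indicator {0..} v *\<^sub>R exp (- v\<^sup>2)) \<partial>lborel)"
    by (rule nn_integral_cong_AE, rule AE_mp[OF AE_lborel_singleton[of 0]])
       (auto split: split_indicator)
  also have "\<dots> = ennreal (sqrt pi / 2)"
    using gaussian_moment_0
    by (subst nn_integral_eq_integral) (auto simp: has_bochner_integral_iff)
  also have "(\<integral>\<^sup>+v. ennreal (exp (- v\<^sup>2)) * indicator {0<..} v \<partial>lborel) =
      ennreal (sqrt s) * (\<integral>\<^sup>+v. ennreal (exp (- s * v\<^sup>2)) * indicator {0<..} v \<partial>lborel)"
    using assms
    by (subst nn_integral_real_affine[where c = "sqrt s" and t = 0])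
       (auto intro!: arg_cong[where f = "\<lambda>x. ennreal (sqrt s) * x"] nn_integral_cong
         simp: power_mult_distrib zero_less_mult_iff split: split_indicator)
  \<comment> \<open>Multiplying by the reciprocal of \<open>sqrt s\<close> isolates the integral
    without dividing in \<open>ennreal\<close>.\<close>
  finally have "ennreal (1 / sqrt s) * ennreal (sqrt s) *
      (\<integral>\<^sup>+v. ennreal (exp (- s * v\<^sup>2)) * indicator {0<..} v \<partial>lborel) =
      ennreal (1 / sqrt s) * ennreal (sqrt pi / 2)"
    by (simp add: mult.assoc)
  then show ?thesis
    using assms by (simp add: ennreal_mult'[symmetric] real_sqrt_divide)
qed

text \<open>For fixed s the Gaussian integral in v contributes sqrt (pi / s) / 2 and so lowers the
  power of s by 1/2. What remains is Euler's integral for Gamma at \<nu> + 1/2 > 0.\<close>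

lemma nn_integral_powr_exp_gaussian:
  fixes \<nu> :: real
  assumes "\<nu> > - 1 / 2"
  shows "(\<integral>\<^sup>+s. \<integral>\<^sup>+v. ennreal (s powr \<nu> * exp (- (s * (1 + v\<^sup>2)))) *
      indicator {0<..} s * indicator {0<..} v \<partial>lborel \<partial>lborel)
     = ennreal (sqrt pi / 2 * Gamma (\<nu> + 1 / 2))"
proof -
  have "(\<integral>\<^sup>+s. \<integral>\<^sup>+v. ennreal (s powr \<nu> * exp (- (s * (1 + v\<^sup>2)))) *
      indicator {0<..} s * indicator {0<..} v \<partial>lborel \<partial>lborel)
     = (\<integral>\<^sup>+s. ennreal (sqrt pi / 2) * ennreal (indicator {0..} s * s powr (\<nu> + 1 / 2 - 1) / exp s) \<partial>lborel)"
  proof (rule nn_integral_cong)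
    fix s :: real
    show "(\<integral>\<^sup>+v. ennreal (s powr \<nu> * exp (- (s * (1 + v\<^sup>2)))) *
          indicator {0<..} s * indicator {0<..} v \<partial>lborel)
      = ennreal (sqrt pi / 2) * ennreal (indicator {0..} s * s powr (\<nu> + 1 / 2 - 1) / exp s)"
    proof (cases "s > 0")
      case True
      have "(\<integral>\<^sup>+v. ennreal (s powr \<nu> * exp (- (s * (1 + v\<^sup>2)))) *
          indicator {0<..} s * indicator {0<..} v \<partial>lborel)
        = (\<integral>\<^sup>+v. ennreal (s powr \<nu> * exp (- s)) * (ennreal (exp (- s * v\<^sup>2)) * indicator {0<..} v) \<partial>lborel)"
        using True
        by (intro nn_integral_cong)
           (auto simp: ennreal_mult'[symmetric] distrib_left exp_add mult_exp_exp split: split_indicator)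
      also have "\<dots> = ennreal (s powr \<nu> * exp (- s) * (sqrt (pi / s) / 2))"
        using True
        by (simp add: nn_integral_cmult nn_integral_gaussian_half_line[simplified]
              ennreal_mult'[symmetric] ennreal_mult''[symmetric])
      also have "s powr \<nu> * exp (- s) * (sqrt (pi / s) / 2) = sqrt pi / 2 * (s powr (\<nu> + 1 / 2 - 1) / exp s)"
      proof -
        have "s powr (\<nu> + 1 / 2 - 1) = s powr \<nu> / sqrt s"
          using True by (simp add: powr_half_sqrt[symmetric] powr_diff[symmetric])
        then show ?thesis by (simp add: real_sqrt_divide exp_minus field_simps)
      qed
      finally show ?thesis using True by (simp add: ennreal_mult'[symmetric])
    qed (auto split: split_indicator)
  qed
  also have "\<dots> = ennreal (sqrt pi / 2 * Gamma (\<nu> + 1 / 2))"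
    by (subst nn_integral_cmult, measurable, subst Gamma_conv_nn_integral_real[symmetric])
       (use assms in \<open>auto simp: ennreal_mult'[symmetric]\<close>)
  finally show ?thesis .
qed

section \<open>Total mass of the Bessel-K density\<close>

lemma borel_measurable_cosh [measurable (raw)]:
  fixes f :: "'a \<Rightarrow> real"
  assumes [measurable]: "f \<in> borel_measurable M"
  shows "(\<lambda>x. cosh (f x)) \<in> borel_measurable M"
  unfolding cosh_def by measurable

lemma borel_measurable_Bessel_K [measurable]: "Bessel_K \<alpha> \<in> borel_measurable borel"
  unfolding Bessel_K_def set_lebesgue_integral_def
  by (rule lborel.borel_measurable_lebesgue_integral) measurable

lemma borel_measurable_BK_density [measurable]: "BK_density p \<in> borel_measurable borel"
  unfolding BK_density_def by measurable

text \<open>With \<open>v = exp t\<close> and then \<open>x = 2 s v\<close>, the exponent \<open>x cosh t\<close> turns into \<open>s (1 + v\<^sup>2)\<close> and all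
  powers of \<open>v\<close> cancel.\<close>

lemma nn_integral_powr_exp_cosh:
  fixes \<nu> :: real
  assumes "\<nu> > - 1 / 2"
  shows "(\<integral>\<^sup>+x. \<integral>\<^sup>+t. ennreal (x powr \<nu> * exp (- x * cosh t) * exp (- \<nu> * t)) * indicator {0<..} x \<partial>lborel \<partial>lborel)
     = ennreal (2 powr \<nu> * sqrt pi * Gamma (\<nu> + 1 / 2))"
proof -
  let ?F = "\<lambda>x t. ennreal (x powr \<nu> * exp (- x * cosh t) * exp (- \<nu> * t)) * indicator {0<..} x"
  let ?H = "\<lambda>s v. ennreal (s powr \<nu> * exp (- (s * (1 + v\<^sup>2)))) * indicator {0<..} s * indicator {0<..} v"
  let ?g = "\<lambda>v. \<integral>\<^sup>+s. ennreal (s powr \<nu> * exp (- (s * (1 + v\<^sup>2)))) * indicator {0<..} s \<partial>lborel"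
  \<comment> \<open>Tonelli: with t fixed, x = 2 exp t * s is a mere scaling. The substitution v =
    exp t follows afterwards in the outer integral.\<close>
  have "(\<integral>\<^sup>+x. \<integral>\<^sup>+t. ?F x t \<partial>lborel \<partial>lborel) = (\<integral>\<^sup>+t. \<integral>\<^sup>+x. ?F x t \<partial>lborel \<partial>lborel)"
    by (rule lborel_pair.Fubini'[symmetric]) measurable
  also have "\<dots> = (\<integral>\<^sup>+t. ennreal (2 powr (\<nu> + 1)) * (?g (exp t) * ennreal (exp t)) \<partial>lborel)"
  proof (rule nn_integral_cong)
    fix t :: real
    have "?F (2 * exp t * s) t =
        ennreal (2 powr \<nu>) * (ennreal (s powr \<nu> * exp (- (s * (1 + (exp t)\<^sup>2)))) * indicator {0<..} s)" for s
    proof (cases "s > 0")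
      case True
      have "(2 * exp t * s) * cosh t = s * (1 + (exp t)\<^sup>2)"
        by (simp add: cosh_def field_simps power2_eq_square exp_minus)
      moreover have "(2 * exp t * s) powr \<nu> * exp (- \<nu> * t) = 2 powr \<nu> * s powr \<nu>"
      proof -
        have "exp t powr \<nu> * exp (- \<nu> * t) = 1"
          by (simp add: powr_def mult_exp_exp)
        then show ?thesis using True by (simp add: powr_mult)
      qed
      moreover have "(2 * exp t * s) powr \<nu> * exp (- (2 * exp t * s) * cosh t) * exp (- \<nu> * t) =
          ((2 * exp t * s) powr \<nu> * exp (- \<nu> * t)) * exp (- ((2 * exp t * s) * cosh t))"
        by (simp add: mult_ac)
      ultimately have "(2 * exp t * s) powr \<nu> * exp (- (2 * exp t * s) * cosh t) * exp (- \<nu> * t) =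
          2 powr \<nu> * (s powr \<nu> * exp (- (s * (1 + (exp t)\<^sup>2))))"
        by (simp only: mult.assoc)
      then have "?F (2 * exp t * s) t = ennreal (2 powr \<nu> * (s powr \<nu> * exp (- (s * (1 + (exp t)\<^sup>2)))))"
        using True by simp
      also have "\<dots> = ennreal (2 powr \<nu>) * ennreal (s powr \<nu> * exp (- (s * (1 + (exp t)\<^sup>2))))"
        by (rule ennreal_mult') simp
      finally show ?thesis using True by simp
    qed (simp add: zero_less_mult_iff split: split_indicator)
    moreover have "(\<integral>\<^sup>+x. ?F x t \<partial>lborel) = ennreal \<bar>2 * exp t\<bar> * (\<integral>\<^sup>+s. ?F (0 + 2 * exp t * s) t \<partial>lborel)"
      by (rule nn_integral_real_affine) auto
    ultimately have "(\<integral>\<^sup>+x. ?F x t \<partial>lborel) = ennreal \<bar>2 * exp t\<bar> *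
        (\<integral>\<^sup>+s. ennreal (2 powr \<nu>) * (ennreal (s powr \<nu> * exp (- (s * (1 + (exp t)\<^sup>2)))) * indicator {0<..} s) \<partial>lborel)"
      by (simp only: add_0)
    also have "\<dots> = ennreal \<bar>2 * exp t\<bar> * (ennreal (2 powr \<nu>) * ?g (exp t))"
      by (subst nn_integral_cmult) auto
    also have "\<dots> = ennreal (\<bar>2 * exp t\<bar> * 2 powr \<nu>) * ?g (exp t)"
      by (subst ennreal_mult') (simp_all add: mult.assoc)
    \<comment> \<open>The Jacobian of the scaling supplies the factor exp t that the substitution v
      = exp t consumes.\<close>
    also have "\<bar>2 * exp t\<bar> * 2 powr \<nu> = 2 powr (\<nu> + 1) * exp t"
      by (simp add: powr_add)
    also have "ennreal (2 powr (\<nu> + 1) * exp t) * ?g (exp t) =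
        ennreal (2 powr (\<nu> + 1)) * (?g (exp t) * ennreal (exp t))"
      by (subst ennreal_mult') (simp_all add: mult_ac)
    finally show "(\<integral>\<^sup>+x. ?F x t \<partial>lborel) = ennreal (2 powr (\<nu> + 1)) * (?g (exp t) * ennreal (exp t))" .
  qed
  also have "\<dots> = ennreal (2 powr (\<nu> + 1)) * (\<integral>\<^sup>+t. ?g (exp t) * ennreal (exp t) \<partial>lborel)"
    by (rule nn_integral_cmult) measurable
  also have "(\<integral>\<^sup>+t. ?g (exp t) * ennreal (exp t) \<partial>lborel) = (\<integral>\<^sup>+v. ?g v * indicator {0<..} v \<partial>lborel)"
    by (rule nn_integral_exp_substitution) measurable
  also have "(\<integral>\<^sup>+v. ?g v * indicator {0<..} v \<partial>lborel) = (\<integral>\<^sup>+v. \<integral>\<^sup>+s. ?H s v \<partial>lborel \<partial>lborel)"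
    by (intro nn_integral_cong nn_integral_multc[symmetric]) measurable
  also have "\<dots> = (\<integral>\<^sup>+s. \<integral>\<^sup>+v. ?H s v \<partial>lborel \<partial>lborel)"
    by (rule lborel_pair.Fubini') measurable
  also have "\<dots> = ennreal (sqrt pi / 2 * Gamma (\<nu> + 1 / 2))"
    by (rule nn_integral_powr_exp_gaussian[OF assms])
  also have "ennreal (2 powr (\<nu> + 1)) * \<dots> = ennreal (2 powr (\<nu> + 1) * (sqrt pi / 2 * Gamma (\<nu> + 1 / 2)))"
    by (rule ennreal_mult'[symmetric]) simp
  also have "2 powr (\<nu> + 1) * (sqrt pi / 2 * Gamma (\<nu> + 1 / 2)) = 2 powr \<nu> * sqrt pi * Gamma (\<nu> + 1 / 2)"
    by (simp add: powr_add)
  finally show ?thesis .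
qed

text \<open>Folding at 0 adds exp (- \<nu> t) and exp (\<nu> t) to 2 cosh (\<nu> t), as cosh is
  even. This links the single exponential, in which the powers of v cancel, to the integrand of
  \<open>Bessel_K\<close>.\<close>

lemma nn_integral_exp_cosh_symmetrize:
  fixes \<nu> x :: real
  shows "(\<integral>\<^sup>+t. ennreal (exp (- x * cosh t) * exp (- \<nu> * t)) \<partial>lborel) =
    2 * (\<integral>\<^sup>+t. ennreal (indicator {0..} t *\<^sub>R (exp (- x * cosh t) * cosh (\<nu> * t))) \<partial>lborel)"
proof -
  have "(\<integral>\<^sup>+t. ennreal (exp (- x * cosh t) * exp (- \<nu> * t)) \<partial>lborel) =
      (\<integral>\<^sup>+t. 2 * ennreal (indicator {0..} t *\<^sub>R (exp (- x * cosh t) * cosh (\<nu> * t))) \<partial>lborel)"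
    by (subst nn_integral_even, measurable)
       (rule nn_integral_cong_AE, rule AE_mp[OF AE_lborel_singleton[of 0]],
        auto simp: cosh_def ennreal_plus[symmetric] ennreal_mult'[symmetric] algebra_simps
          simp flip: ennreal_numeral ennreal_plus split: split_indicator)
  then show ?thesis by (simp add: nn_integral_cmult)
qed

text \<open>Tonelli's theorem shows at the same time that the integral defining \<open>K\<^sub>\<nu>(x)\<close> converges for almost
  every \<open>x > 0\<close>; a divergent integral would have the junk value \<open>0\<close>.\<close>

lemma nn_integral_powr_Bessel_K:
  fixes \<nu> :: real
  assumes "\<nu> > - 1 / 2"
  shows "2 * (\<integral>\<^sup>+x. ennreal (x powr \<nu> * Bessel_K \<nu> x) * indicator {0<..} x \<partial>lborel)
     = ennreal (2 powr \<nu> * sqrt pi * Gamma (\<nu> + 1 / 2))"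
proof -
  let ?k = "\<lambda>x t. indicator {0..} t *\<^sub>R (exp (- x * cosh t) * cosh (\<nu> * t))"
  let ?N = "\<lambda>x. \<integral>\<^sup>+t. ennreal (?k x t) \<partial>lborel"
  have k_nonneg: "0 \<le> ?k x t" for x t by simp
  have "ennreal (2 powr \<nu> * sqrt pi * Gamma (\<nu> + 1 / 2)) =
      (\<integral>\<^sup>+x. ennreal (x powr \<nu>) * indicator {0<..} x *
        (\<integral>\<^sup>+t. ennreal (exp (- x * cosh t) * exp (- \<nu> * t)) \<partial>lborel) \<partial>lborel)"
    unfolding nn_integral_powr_exp_cosh[OF assms, symmetric]
    by (subst nn_integral_cmult[symmetric])
       (auto simp: ennreal_mult' mult_ac intro!: nn_integral_cong)
  also have "\<dots> = (\<integral>\<^sup>+x. 2 * (ennreal (x powr \<nu>) * indicator {0<..} x * ?N x) \<partial>lborel)"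
    unfolding nn_integral_exp_cosh_symmetrize by (simp add: mult_ac)
  also have "\<dots> = 2 * (\<integral>\<^sup>+x. ennreal (x powr \<nu>) * indicator {0<..} x * ?N x \<partial>lborel)"
    by (rule nn_integral_cmult) measurable
  finally have eq: "2 * (\<integral>\<^sup>+x. ennreal (x powr \<nu>) * indicator {0<..} x * ?N x \<partial>lborel) =
      ennreal (2 powr \<nu> * sqrt pi * Gamma (\<nu> + 1 / 2))" ..
  then have "(\<integral>\<^sup>+x. ennreal (x powr \<nu>) * indicator {0<..} x * ?N x \<partial>lborel) \<noteq> \<infinity>"
    by (auto simp: ennreal_mult_top)
  then have "AE x in lborel. ennreal (x powr \<nu>) * indicator {0<..} x * ?N x \<noteq> \<infinity>"
    by (intro nn_integral_noteq_infinite) auto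
  then have "AE x in lborel. ennreal (x powr \<nu>) * indicator {0<..} x * ?N x =
      ennreal (x powr \<nu> * Bessel_K \<nu> x) * indicator {0<..} x"
  proof eventually_elim
    case (elim x)
    show ?case
    proof (cases "x > 0")
      case True
      then have "?N x < \<infinity>"
        using elim by (auto simp: ennreal_mult_eq_top_iff less_top)
      then have "integrable lborel (?k x)"
        by (intro integrableI_nonneg) (use k_nonneg in auto)
      then have "?N x = ennreal (Bessel_K \<nu> x)"
        unfolding Bessel_K_def set_lebesgue_integral_def
        by (intro nn_integral_eq_integral) (use k_nonneg in auto)
      then show ?thesis using True by (simp add: ennreal_mult')
    qed simp
  qed
  then show ?thesis
    using eq by (subst (asm) nn_integral_cong_AE) auto
qed

text \<open>The density is even, so its mass is twice the half-line integral. With \<nu> = p - 1/2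
  that integral is the reciprocal of the normalising constant, and p > 0 is exactly \<nu> > -
  1/2.\<close>

lemma prob_space_BK1:
  assumes "p > 0"
  shows "prob_space (BK1 p)"
proof
  define c where "c = 1 / (sqrt pi * Gamma p * 2 powr (p - 1 / 2))"
  let ?h = "\<lambda>t. ennreal (t powr (p - 1 / 2) * Bessel_K (p - 1 / 2) t)"
  have Gamma_pos: "Gamma p > 0" using assms by (rule Gamma_real_pos)
  then have c: "c > 0" by (simp add: c_def)
  have "emeasure (BK1 p) (space (BK1 p)) = (\<integral>\<^sup>+t. ennreal (BK_density p t) \<partial>lborel)"
    by (simp add: BK1_def emeasure_density)
  also have "\<dots> = (\<integral>\<^sup>+t. (ennreal (BK_density p t) + ennreal (BK_density p (- t))) * indicator {0<..} t \<partial>lborel)"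
    by (rule nn_integral_even) measurable
  also have "\<dots> = (\<integral>\<^sup>+t. ennreal c * (2 * (?h t * indicator {0<..} t)) \<partial>lborel)"
  proof (rule nn_integral_cong)
    fix t :: real
    have "BK_density p t = c * (t powr (p - 1 / 2) * Bessel_K (p - 1 / 2) t)"
      "BK_density p (- t) = c * (t powr (p - 1 / 2) * Bessel_K (p - 1 / 2) t)" if "t > 0"
      using that by (simp_all add: BK_density_def c_def)
    \<comment> \<open>True for negative z too, where both sides are 0 because \<open>ennreal\<close>
      truncates; hence the sign of \<open>Bessel_K\<close> is not an issue.\<close>
    moreover have "ennreal (c * z) + ennreal (c * z) = ennreal c * (2 * ennreal z)" for z
      using c by (simp add: ennreal_mult' mult_2 distrib_left)
    ultimately show "(ennreal (BK_density p t) + ennreal (BK_density p (- t))) * indicator {0<..} t =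
        ennreal c * (2 * (?h t * indicator {0<..} t))"
      by (simp split: split_indicator)
  qed
  also have "\<dots> = ennreal c * (2 * (\<integral>\<^sup>+t. ?h t * indicator {0<..} t \<partial>lborel))"
    by (subst nn_integral_cmult, measurable, subst nn_integral_cmult) auto
  also have "\<dots> = ennreal c * ennreal (2 powr (p - 1 / 2) * sqrt pi * Gamma p)"
    using nn_integral_powr_Bessel_K[of "p - 1 / 2"] assms by simp
  also have "\<dots> = 1"
    using c Gamma_pos by (simp add: ennreal_mult'[symmetric] c_def)
  finally show "emeasure (BK1 p) (space (BK1 p)) = 1" .
qed

section \<open>Radon measures and the Hellinger distance of densities\<close>

text \<open>Finite Borel measures on a Polish space are inner regular with respect to compact
  sets.\<close>

lemma radon_prob_iff_prob_space_borel:
  fixes M :: "'a::{second_countable_topology, complete_space} measure"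
  shows "M \<in> radon_prob \<longleftrightarrow> prob_space M \<and> sets M = sets borel"
proof
  assume *: "prob_space M \<and> sets M = sets borel"
  then interpret prob_space M by simp
  have "emeasure M B = (SUP K\<in>{K. K \<subseteq> B \<and> compact K}. emeasure M K)" if "B \<in> sets borel" for B
    using * that emeasure_finite by (intro inner_regular) auto
  with * show "M \<in> radon_prob"
    by (simp add: radon_prob_def)
qed (simp add: radon_prob_def)

text \<open>The definition picks an unspecified dominating measure \<open>\<Theta>\<close>. If
  \<open>M\<close> has density \<open>D\<close> with respect to it, the two measures have densities
  \<open>D * a\<close> and \<open>D * b\<close>, and \<open>D\<close> factors out of the squared
  difference of the roots, leaving an integral against \<open>M\<close>.\<close>

lemma hellinger_density:
  fixes M :: "'a::topological_space measure" and a b :: "'a \<Rightarrow> real"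
  assumes M: "M \<in> radon_prob"
    and a[measurable]: "a \<in> borel_measurable M" and b[measurable]: "b \<in> borel_measurable M"
    and a_pos: "\<And>u. a u > 0" and b_pos: "\<And>u. b u > 0"
  shows "hellinger (density M a) (density M b) =
           sqrt (1 / 2 * (LINT u|M. (sqrt (a u) - sqrt (b u))\<^sup>2))"
proof -
  define P where "P \<Theta> \<longleftrightarrow> \<Theta> \<in> radon_prob \<and> absolutely_continuous \<Theta> (density M a) \<and>
    absolutely_continuous \<Theta> (density M b)" for \<Theta>
  define \<Theta> where "\<Theta> = (SOME \<Theta>. P \<Theta>)"
  \<comment> \<open>\<open>M\<close> itself is admissible, so the choice of \<open>\<Theta>\<close>
    satisfies \<open>P\<close>.\<close>
  have "P M"
    using M by (simp add: P_def absolutely_continuousI_density)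
  then have "P \<Theta>"
    unfolding \<Theta>_def by (rule someI)
  then have \<Theta>: "\<Theta> \<in> radon_prob" "absolutely_continuous \<Theta> (density M a)"
    by (simp_all add: P_def)
  interpret M: prob_space M using M by (simp add: radon_prob_def)
  interpret \<Theta>: prob_space \<Theta> using \<Theta>(1) by (simp add: radon_prob_def)
  have sets_eq[measurable_cong]: "sets \<Theta> = sets M"
    using M \<Theta>(1) by (simp add: radon_prob_def)
  \<comment> \<open>Since \<open>a > 0\<close>, the measure \<open>M\<close> is itself dominated by \<open>\<Theta>\<close>.\<close>
  have "A \<in> null_sets (density M a) \<longleftrightarrow> A \<in> null_sets M" for A
  proof -
    have "(AE u in M. u \<in> A \<longrightarrow> ennreal (a u) = 0) \<longleftrightarrow> (AE u in M. u \<notin> A)"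
      using a_pos by (simp add: ennreal_eq_0_iff linorder_not_less[symmetric])
    moreover have "A \<in> null_sets (density M a) \<longleftrightarrow>
        A \<in> sets M \<and> (AE u in M. u \<in> A \<longrightarrow> ennreal (a u) = 0)"
      by (rule null_sets_density_iff) measurable
    ultimately show ?thesis
      by (metis AE_iff_null_sets null_setsD2)
  qed
  then have "null_sets (density M a) = null_sets M" by blast
  then have ac: "absolutely_continuous \<Theta> M"
    using \<Theta>(2) by (simp add: absolutely_continuous_def)
  \<comment> \<open>A finite version of the density, so that the square roots can be computed in the
    reals.\<close>
  obtain D where D[measurable]: "D \<in> borel_measurable \<Theta>"
    and D_RN: "AE u in \<Theta>. RN_deriv \<Theta> M u = ennreal (D u)" and D_nonneg: "\<And>u. 0 \<le> D u"
    using \<Theta>.real_RN_deriv[OF M.finite_measure_axioms ac] sets_eq by metis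
  have M_eq: "M = density \<Theta> D"
    using \<Theta>.density_RN_deriv[OF ac] sets_eq density_cong[OF _ _ D_RN] by simp
  \<comment> \<open>Chain rule for densities, together with almost-everywhere uniqueness of the
    Radon-Nikodym derivative.\<close>
  have RN: "AE u in \<Theta>. RN_deriv \<Theta> (density M f) u = ennreal (D u * f u)"
    if f[measurable]: "f \<in> borel_measurable M" and f_pos: "\<And>u. f u > 0" for f
  proof -
    have [measurable]: "f \<in> borel_measurable \<Theta>"
      using f sets_eq by (simp cong: measurable_cong_sets)
    have "density \<Theta> (\<lambda>u. ennreal (D u * f u)) = density M f"
      by (subst M_eq, subst density_density_eq)
         (use D_nonneg f_pos in \<open>auto simp: ennreal_mult' less_imp_le\<close>)
    then have "AE u in \<Theta>. ennreal (D u * f u) = RN_deriv \<Theta> (density M f) u"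
      by (rule \<Theta>.RN_deriv_unique[rotated]) measurable
    then show ?thesis
      by eventually_elim (rule sym)
  qed
  have [measurable]: "a \<in> borel_measurable \<Theta>" "b \<in> borel_measurable \<Theta>"
    using a b sets_eq by (simp_all cong: measurable_cong_sets)
  have "(LINT u|\<Theta>. (sqrt (enn2real (RN_deriv \<Theta> (density M a) u)) -
            sqrt (enn2real (RN_deriv \<Theta> (density M b) u)))\<^sup>2) =
        (LINT u|\<Theta>. D u *\<^sub>R (sqrt (a u) - sqrt (b u))\<^sup>2)"
  proof (rule integral_cong_AE)
    show "AE u in \<Theta>. (sqrt (enn2real (RN_deriv \<Theta> (density M a) u)) -
            sqrt (enn2real (RN_deriv \<Theta> (density M b) u)))\<^sup>2 =
          D u *\<^sub>R (sqrt (a u) - sqrt (b u))\<^sup>2"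
      using RN[OF a a_pos] RN[OF b b_pos]
    proof eventually_elim
      case (elim u)
      show ?case
        using D_nonneg[of u] a_pos[of u] b_pos[of u]
        by (simp add: elim real_sqrt_mult power2_eq_square algebra_simps)
    qed
  qed measurable
  also have "\<dots> = (LINT u|M. (sqrt (a u) - sqrt (b u))\<^sup>2)"
    by (subst M_eq, subst integral_density) (use D_nonneg in auto)
  finally show ?thesis
    unfolding hellinger_def Let_def P_def[symmetric] \<Theta>_def[symmetric] by simp
qed

section \<open>Well-posedness for nonnegative potentials that are continuous in the data\<close>

lemma well_posed_if_nonneg_continuous:
  fixes M :: "'a::{second_countable_topology, complete_space} measure"
    and \<Phi> :: "'a \<Rightarrow> 'd::real_normed_vector \<Rightarrow> real"
  assumes M: "M \<in> radon_prob"
    and meas[measurable]: "\<And>y. (\<lambda>u. \<Phi> u y) \<in> borel_measurable M"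
    and nonneg: "\<And>u y. 0 \<le> \<Phi> u y"
    and cont: "\<And>u y. isCont (\<Phi> u) y"
  shows "well_posed M \<Phi>"
proof -
  interpret prob_space M using M by (simp add: radon_prob_def)
  have sets_M: "sets M = sets borel" using M by (simp add: radon_prob_def)
  define Z where "Z = evidence M \<Phi>"
  define \<rho> where "\<rho> y u = 1 / Z y * exp (- \<Phi> u y)" for y u
  have [measurable]: "\<rho> y \<in> borel_measurable M" for y
    unfolding \<rho>_def by measurable
  have integrable_exp: "integrable M (\<lambda>u. exp (- \<Phi> u y))" for y
    by (rule integrable_const_bound[of _ 1]) (auto simp: nonneg)
  have Z_pos: "Z y > 0" for y
  proof -
    \<comment> \<open>A strictly positive integrand has integral 0 only over a null space, and
      \<open>M\<close> has mass 1.\<close>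
    have "Z y \<noteq> 0"
      unfolding Z_def evidence_def
      by (subst integral_nonneg_eq_0_iff_AE) (auto simp: integrable_exp)
    moreover have "Z y \<ge> 0"
      unfolding Z_def evidence_def by simp
    ultimately show ?thesis by simp
  qed
  have \<rho>_pos: "\<rho> y u > 0" for y u
    using Z_pos by (simp add: \<rho>_def)
  have integral_\<rho>: "(LINT u|M. \<rho> y u) = 1" for y
    using Z_pos[of y] by (simp add: \<rho>_def Z_def evidence_def)
  have integrable_\<rho>: "integrable M (\<rho> y)" for y
    using integrable_exp unfolding \<rho>_def by simp
  have "prob_space (density M (\<rho> y))" for y
    by (rule prob_spaceI)
       (simp add: emeasure_density nn_integral_eq_integral integrable_\<rho> integral_\<rho>
          less_imp_le \<rho>_pos cong: nn_integral_cong_simp)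
  then have density_radon: "density M (\<rho> y) \<in> radon_prob" for y
    by (simp add: radon_prob_iff_prob_space_borel sets_M)
  \<comment> \<open>An absolutely continuous measure is recovered from its Radon-Nikodym derivative.
    This yields existence and uniqueness at once and evaluates the description in
    \<open>posterior\<close>.\<close>
  have posterior_iff: "is_posterior M \<Phi> y \<mu> \<longleftrightarrow> \<mu> = density M (\<rho> y)" for y \<mu>
  proof
    assume *: "is_posterior M \<Phi> y \<mu>"
    then have "density M (RN_deriv M \<mu>) = \<mu>"
      using sets_M by (intro density_RN_deriv) (auto simp: is_posterior_def radon_prob_def)
    moreover have "density M (RN_deriv M \<mu>) = density M (\<rho> y)"
      using * by (intro density_cong) (auto simp: is_posterior_def \<rho>_def Z_def)
    ultimately show "\<mu> = density M (\<rho> y)" by simp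
  next
    assume *: "\<mu> = density M (\<rho> y)"
    have "AE u in M. ennreal (\<rho> y u) = RN_deriv M \<mu> u"
      by (rule RN_deriv_unique) (auto simp: *)
    then have "AE u in M. RN_deriv M \<mu> u = ennreal (1 / evidence M \<Phi> y * exp (- \<Phi> u y))"
      by eventually_elim (simp add: \<rho>_def Z_def)
    then show "is_posterior M \<Phi> y \<mu>"
      using density_radon[of y] unfolding is_posterior_def *
      by (simp add: absolutely_continuousI_density)
  qed
  then have posterior_eq: "posterior M \<Phi> y = density M (\<rho> y)" for y
    by (simp add: posterior_def)

  \<comment> \<open>The unnormalised Hellinger affinity of the two posteriors: the cross term left
    after expanding the square, with \<open>K y y = Z y\<close>.\<close>
  define K where "K y z = (LINT u|M. exp (- (\<Phi> u y / 2)) * exp (- (\<Phi> u z / 2)))" for y z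
  have exp_half: "exp (- (x / 2)) * exp (- (x / 2)) = exp (- x)" for x :: real
    by (simp add: mult_exp_exp)
  have sqrt_\<rho>: "sqrt (\<rho> y u) = exp (- (\<Phi> u y / 2)) / sqrt (Z y)" for y u
    using Z_pos[of y]
    by (intro real_sqrt_unique) (auto simp: \<rho>_def power2_eq_square exp_half)
  have hellinger_eq: "hellinger (density M (\<rho> y)) (density M (\<rho> z)) =
      sqrt (1 - K y z / (sqrt (Z y) * sqrt (Z z)))" for y z
  proof -
    have int: "integrable M (\<lambda>u. exp (- (\<Phi> u y / 2)) * exp (- (\<Phi> u z / 2)))"
      by (rule integrable_const_bound[of _ 1]) (auto simp: nonneg mult_le_one)
    have "(sqrt (\<rho> y u) - sqrt (\<rho> z u))\<^sup>2 = \<rho> y u + \<rho> z u -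
        2 / (sqrt (Z y) * sqrt (Z z)) * (exp (- (\<Phi> u y / 2)) * exp (- (\<Phi> u z / 2)))" for u
    proof -
      have "(sqrt (\<rho> y u) - sqrt (\<rho> z u))\<^sup>2 = \<rho> y u + \<rho> z u - 2 * (sqrt (\<rho> y u) * sqrt (\<rho> z u))"
        using \<rho>_pos[of y u] \<rho>_pos[of z u] by (simp add: power2_diff less_imp_le)
      then show ?thesis by (simp add: sqrt_\<rho>)
    qed
    then have "(LINT u|M. (sqrt (\<rho> y u) - sqrt (\<rho> z u))\<^sup>2) = 2 - 2 / (sqrt (Z y) * sqrt (Z z)) * K y z"
      unfolding K_def using int by (simp add: integrable_\<rho> integral_\<rho> del: times_divide_eq_left)
    then show ?thesis
      by (subst hellinger_density[OF M]) (auto simp: \<rho>_pos)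
  qed

  \<comment> \<open>Stated along sequences to suit dominated convergence; the data space is metric,
    so sequences detect continuity.\<close>
  have Z_lim: "(\<lambda>n. Z (Y n)) \<longlonglongrightarrow> Z y" and K_lim: "(\<lambda>n. K y (Y n)) \<longlonglongrightarrow> Z y"
    if Y: "Y \<longlonglongrightarrow> y" for Y y
  proof -
    have \<Phi>_lim: "(\<lambda>n. \<Phi> u (Y n)) \<longlonglongrightarrow> \<Phi> u y" for u
      using isCont_tendsto_compose[OF cont Y] .
    show "(\<lambda>n. Z (Y n)) \<longlonglongrightarrow> Z y"
      unfolding Z_def evidence_def
      by (rule integral_dominated_convergence[where w = "\<lambda>_. 1"])
         (auto intro!: tendsto_intros \<Phi>_lim simp: nonneg)
    have "(\<lambda>n. exp (- (\<Phi> u y / 2)) * exp (- (\<Phi> u (Y n) / 2))) \<longlonglongrightarrow> exp (- \<Phi> u y)" for u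
      unfolding exp_half[of "\<Phi> u y", symmetric] by (intro tendsto_intros \<Phi>_lim) simp
    then show "(\<lambda>n. K y (Y n)) \<longlonglongrightarrow> Z y"
      unfolding Z_def evidence_def K_def
      by (intro integral_dominated_convergence[where w = "\<lambda>_. 1"])
         (auto simp: nonneg mult_le_one)
  qed
  have "isCont (\<lambda>z. hellinger (density M (\<rho> y)) (density M (\<rho> z))) y" for y
    unfolding continuous_at_sequentially comp_def hellinger_eq
  proof (intro allI impI)
    fix Y assume Y: "Y \<longlonglongrightarrow> y"
    have "K y y = Z y"
      by (simp add: K_def exp_half Z_def evidence_def)
    then show "(\<lambda>n. sqrt (1 - K y (Y n) / (sqrt (Z y) * sqrt (Z (Y n))))) \<longlonglongrightarrow>
        sqrt (1 - K y y / (sqrt (Z y) * sqrt (Z y)))"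
      using Z_pos[of y] by (intro tendsto_intros) (auto intro: Z_lim[OF Y] K_lim[OF Y])
  qed
  moreover have "hellinger (density M (\<rho> y)) (density M (\<rho> y)) = 0" for y
    by (subst hellinger_density[OF M]) (auto simp: \<rho>_pos)
  ultimately have "\<exists>\<delta>>0. \<forall>z. norm (y - z) < \<delta> \<longrightarrow> hellinger (density M (\<rho> y)) (density M (\<rho> z)) < \<epsilon>"
    if "\<epsilon> > 0" for y \<epsilon>
    using that unfolding continuous_at_eps_delta
    by (fastforce simp: dist_norm norm_minus_commute abs_less_iff)
  moreover have "\<exists>!\<mu>. is_posterior M \<Phi> y \<mu>" for y
    unfolding posterior_iff by simp
  ultimately show ?thesis
    unfolding well_posed_def posterior_eq by simp
qed

section \<open>Continuity of the potential and the law of the random series\<close>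

lemma continuous_on_weighted_norm: "continuous_on UNIV (weighted_norm \<Sigma>)"
  unfolding weighted_norm_def
  by (intro continuous_intros linear_continuous_on matrix_vector_mul_bounded_linear)

text \<open>Every point is interior to a ball on which f is Lipschitz.\<close>

lemma locally_lipschitz_imp_continuous_on:
  assumes "locally_lipschitz f"
  shows "continuous_on UNIV f"
proof -
  have "isCont f u" for u
  proof -
    obtain e L where "e > 0" and L: "L-lipschitz_on (ball u e) f"
      using assms unfolding locally_lipschitz_def by blast
    then show ?thesis
      using continuous_on_interior[OF lipschitz_on_continuous_on[OF L], of u] by simp
  qed
  then show ?thesis
    by (simp add: continuous_at_imp_continuous_on)
qed

text \<open>The law is the image of a product probability measure under a Borel map. Divergent
  series all receive the same default value, so the sum is measurable on the whole sample
  space.\<close>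

lemma BK_prior_radon_prob:
  assumes "prob_space (BK1 p)"
  shows "BK_prior p \<gamma> (r :: nat \<Rightarrow> 'a::{real_inner, banach, second_countable_topology}) \<in> radon_prob"
proof -
  have [measurable_cong]: "sets (BK1 p) = sets borel" by (simp add: BK1_def)
  interpret prob_space "\<Pi>\<^sub>M k\<in>(UNIV::nat set). BK1 p"
    by (intro prob_space_PiM assms)
  have "prob_space (BK_prior p \<gamma> r)"
    unfolding BK_prior_def by (rule prob_space_distr) measurable
  then show ?thesis
    by (simp add: radon_prob_iff_prob_space_borel BK_prior_def)
qed

theorem corollary4p1:
  fixes \<Sigma> :: "real^'m^'m"
    and G :: "'x::{real_inner, banach, second_countable_topology} \<Rightarrow> real^'m"
    and R :: "'x \<Rightarrow> 'x"
    and \<gamma> :: "nat \<Rightarrow> real"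
    and r :: "nat \<Rightarrow> 'x"
    and p :: real
  assumes "sym_pos_def \<Sigma>"
    and "locally_lipschitz G"
    and "polynomially_bounded G"
    and "p > 0"
    and "hilbert_schmidt R"
    and "orthonormal_basis (UNIV :: nat set) r"
    and "\<And>k. R (r k) = \<gamma> k *\<^sub>R r k"
    and "summable (\<lambda>k. (\<gamma> k)\<^sup>2)"
  shows "well_posed (BK_prior p \<gamma> r) (potential \<Sigma> G)"
proof (rule well_posed_if_nonneg_continuous)
  show prior: "BK_prior p \<gamma> r \<in> radon_prob"
    by (intro BK_prior_radon_prob prob_space_BK1 \<open>p > 0\<close>)
  \<comment> \<open>Continuity in u provides the Borel measurability of the potential; continuity in
    y is the separate condition on the data.\<close>
  have cont: "continuous_on UNIV (\<lambda>u. potential \<Sigma> G u y)" for y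
    unfolding potential_def
    by (intro continuous_intros continuous_on_compose2[OF continuous_on_weighted_norm]
          locally_lipschitz_imp_continuous_on[OF \<open>locally_lipschitz G\<close>]) auto
  have "sets (BK_prior p \<gamma> r) = sets borel"
    using prior by (simp add: radon_prob_def)
  then show "(\<lambda>u. potential \<Sigma> G u y) \<in> borel_measurable (BK_prior p \<gamma> r)" for y
    using borel_measurable_continuous_onI[OF cont] by (simp cong: measurable_cong_sets)
  have "continuous_on UNIV (potential \<Sigma> G u)" for u
    unfolding potential_def
    by (intro continuous_intros continuous_on_compose2[OF continuous_on_weighted_norm]) auto
  then show "isCont (potential \<Sigma> G u) y" for u y
    by (simp add: continuous_on_eq_continuous_at)
qed (simp add: potential_def)

end
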